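(* Let $\mu>0$, $\nu>0$ be constants and $\theta\in(0,1)$. Consider Burgers' equation $$u_t-\mu u_{xx}+\nu u u_x=f(x,t)\ \text{ in }(0,1)\times\mathbb{R}_{+},\qquad u(0,t)=0,\ u(1,t)=d(t),\qquad u(x,0)=u_0(x).$$ This system is EISS in $L^2$-norm with respect to boundary disturbances $d\in\mathcal{H}^{1+\frac{\theta}{2}}(\mathbb{R}_{\geq 0})$ and in-domain disturbances $f\in\mathcal{H}^{\theta,\frac{\theta}{2}}([0,1]\times\mathbb{R}_{\geq 0})$ satisfying $$\sup_{s\in\mathbb{R}_{\geq 0}}|d(s)|+\frac{4\sqrt{2}}{\mu}\sup_{(x,s)\in[0,1]\times\mathbb{R}_{\geq 0}}|f(x,s)|<\frac{\mu}{\nu},$$ and, for all such $d,f$ and every admissible initial datum $u_0$, the solution $u$ satisfies, for any $t>0$, $$\|u(\cdot,t)\|^2\leq 2\|u_0\|^2e^{-\mu t}+4\max_{s\in[0,t]}|d(s)|^2+\frac{128}{\mu^2}\max_{(x,s)\in[0,1]\times[0,t]}|f(x,s)|^2.$$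
   Context: Notation: $\mathbb{R}_+=(0,+\infty)$, $\mathbb{R}_{\ge0}=[0,+\infty)$, and $\|\cdot\|=\|\cdot\|_{L^2(0,1)}$. The spaces $\mathcal{H}^{l}$ and $\mathcal{H}^{l,\frac l2}$ ($l>0$ non-integer) are the usual (parabolic) Hölder spaces: $\mathcal{H}^{2+\theta}([0,1])$ consists of $C^2$ functions whose second derivative is $\theta$-Hölder; $\mathcal{H}^{1+\frac\theta2}(\mathbb{R}_{\ge0})$ consists of $C^1$ functions, bounded with bounded derivative, whose derivative is $\frac\theta2$-Hölder; $\mathcal{H}^{\theta,\frac\theta2}([0,1]\times\mathbb{R}_{\ge0})$ consists of bounded functions that are $\theta$-Hölder in $x$ and $\frac\theta2$-Hölder in $t$ (uniformly). Standing assumptions: $u_0\in\mathcal{H}^{2+\theta}([0,1])$, $f\in\mathcal{H}^{\theta,\frac\theta2}([0,1]\times\mathbb{R}_{\ge0})$, $d\in\mathcal{H}^{1+\frac\theta2}(\mathbb{R}_{\ge0})$, and the compatibility conditions $u_0(0)=u_0''(0)=u_0(1)=u_0''(1)=d(0)=d'(0)=f(0,0)=f(1,0)=0$ hold (an initial datum is admissible if it satisfies these conditions). The solution $u$ is the unique classical solution in $C^{2,1}([0,1]\times\mathbb{R}_{\ge0})$. Comparison functions: $\mathcal K$ is the set of continuous strictly increasing $\gamma:\mathbb{R}_{\ge0}\to\mathbb{R}_{\ge0}$ with $\gamma(0)=0$; $\mathcal K_\infty$ is the set of $\gamma\in\mathcal K$ with $\lim_{s\to\infty}\gamma(s)=\infty$;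 $\mathcal{L}$ is the set of continuous strictly decreasing $\gamma:\mathbb{R}_{\ge0}\to\mathbb{R}_{\ge0}$ with $\lim_{s\to\infty}\gamma(s)=0$; $\mathcal{KL}$ is the set of $\beta:\mathbb{R}_{\ge0}\times\mathbb{R}_{\ge0}\to\mathbb{R}_{\ge0}$ with $\beta(\cdot,t)\in\mathcal K$ for all $t\in\mathbb{R}_{\ge0}$ and $\beta(s,\cdot)\in\mathcal L$ for all $s\in\mathbb{R}_+$. Definition (ISS and EISS): the system is input-to-state stable (ISS) in $L^q$-norm ($2\le q\le+\infty$) with respect to $d$ and $f$ if there exist $\beta\in\mathcal{KL}$ and $\gamma_1,\gamma_2\in\mathcal K$ such that its solutions satisfy, for all $t\ge0$, $$\|u(\cdot,t)\|_{L^q(0,1)}\le\beta(\|u_0\|_{L^q(0,1)},t)+\gamma_1\Big(\max_{s\in[0,t]}|d(s)|\Big)+\gamma_2\Big(\max_{(x,s)\in[0,1]\times[0,t]}|f(x,s)|\Big).$$ It is exponentially input-to-state stable (EISS) if moreover there exist $\beta'\in\mathcal K_\infty$ and a constant $\lambda>0$ such that $\beta(\|u_0\|_{L^q(0,1)},t)\le\beta'(\|u_0\|_{L^q(0,1)})e^{-\lambda t}$. *)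

theory Defs
  imports "HOL-Analysis.Analysis"
begin

text \<open>
  Functions of \<open>(x, t)\<close> are curried, \<open>u x t\<close>.  Only values with \<open>x \<in> {0..1}\<close>, \<open>t \<in> {0..}\<close>
  matter: derivatives are taken within these sets, hence are one-sided at the end points.
\<close>

definition deriv_within :: "(real \<Rightarrow> real) \<Rightarrow> real set \<Rightarrow> real \<Rightarrow> real" where
  "deriv_within g S x = vector_derivative g (at x within S)"

definition Dx :: "(real \<Rightarrow> real \<Rightarrow> real) \<Rightarrow> real \<Rightarrow> real \<Rightarrow> real" where
  "Dx u x t = deriv_within (\<lambda>y. u y t) {0..1} x"

definition Dt :: "(real \<Rightarrow> real \<Rightarrow> real) \<Rightarrow> real \<Rightarrow> real \<Rightarrow> real" where
  "Dt u x t = deriv_within (\<lambda>s. u x s) {0..} t"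


subsection \<open>Function spaces\<close>

definition holder_on :: "real \<Rightarrow> real set \<Rightarrow> (real \<Rightarrow> real) \<Rightarrow> bool" where
  "holder_on \<alpha> S g \<longleftrightarrow> (\<exists>C. \<forall>x\<in>S. \<forall>y\<in>S. \<bar>g x - g y\<bar> \<le> C * \<bar>x - y\<bar> powr \<alpha>)"

definition H_initial :: "real \<Rightarrow> (real \<Rightarrow> real) set" where
  "H_initial \<theta> = {g.
     g differentiable_on {0..1} \<and>
     deriv_within g {0..1} differentiable_on {0..1} \<and>
     continuous_on {0..1} (deriv_within (deriv_within g {0..1}) {0..1}) \<and>
     holder_on \<theta> {0..1} (deriv_within (deriv_within g {0..1}) {0..1})}"

definition H_boundary :: "real \<Rightarrow> (real \<Rightarrow> real) set" where
  "H_boundary \<theta> = {g.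
     g differentiable_on {0..} \<and>
     continuous_on {0..} (deriv_within g {0..}) \<and>
     bounded (g ` {0..}) \<and>
     bounded (deriv_within g {0..} ` {0..}) \<and>
     holder_on (\<theta> / 2) {0..} (deriv_within g {0..})}"

definition H_parabolic :: "real \<Rightarrow> (real \<Rightarrow> real \<Rightarrow> real) set" where
  "H_parabolic \<theta> = {f.
     bounded ((\<lambda>(x, t). f x t) ` ({0..1} \<times> {0..})) \<and>
     (\<exists>C. \<forall>x\<in>{0..1}. \<forall>y\<in>{0..1}. \<forall>t\<in>{0..}. \<bar>f x t - f y t\<bar> \<le> C * \<bar>x - y\<bar> powr \<theta>) \<and>
     (\<exists>C. \<forall>x\<in>{0..1}. \<forall>s\<in>{0..}. \<forall>t\<in>{0..}. \<bar>f x s - f x t\<bar> \<le> C * \<bar>s - t\<bar> powr (\<theta> / 2))}"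

definition C21 :: "(real \<Rightarrow> real \<Rightarrow> real) set" where
  "C21 = {u.
     (\<forall>t\<in>{0..}. (\<lambda>x. u x t) differentiable_on {0..1}) \<and>
     (\<forall>t\<in>{0..}. (\<lambda>x. Dx u x t) differentiable_on {0..1}) \<and>
     (\<forall>x\<in>{0..1}. (\<lambda>t. u x t) differentiable_on {0..}) \<and>
     continuous_on ({0..1} \<times> {0..}) (\<lambda>(x, t). u x t) \<and>
     continuous_on ({0..1} \<times> {0..}) (\<lambda>(x, t). Dx u x t) \<and>
     continuous_on ({0..1} \<times> {0..}) (\<lambda>(x, t). Dx (Dx u) x t) \<and>
     continuous_on ({0..1} \<times> {0..}) (\<lambda>(x, t). Dt u x t)}"

definition L2_norm :: "(real \<Rightarrow> real) \<Rightarrow> real" where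
  "L2_norm g = sqrt (LBINT x:{0<..<1}. (g x)\<^sup>2)"


subsection \<open>Comparison functions\<close>

definition class_K :: "(real \<Rightarrow> real) set" where
  "class_K = {\<gamma>. \<gamma> \<in> {0..} \<rightarrow> {0..} \<and> continuous_on {0..} \<gamma> \<and> strict_mono_on {0..} \<gamma> \<and> \<gamma> 0 = 0}"

definition class_K_inf :: "(real \<Rightarrow> real) set" where
  "class_K_inf = {\<gamma> \<in> class_K. filterlim \<gamma> at_top at_top}"

definition class_L :: "(real \<Rightarrow> real) set" where
  "class_L = {\<gamma>. \<gamma> \<in> {0..} \<rightarrow> {0..} \<and> continuous_on {0..} \<gamma> \<and> strict_antimono_on {0..} \<gamma> \<and>
     (\<gamma> \<longlongrightarrow> 0) at_top}"

definition class_KL :: "(real \<Rightarrow> real \<Rightarrow> real) set" where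
  "class_KL = {\<beta>. (\<forall>t\<ge>0. (\<lambda>s. \<beta> s t) \<in> class_K) \<and> (\<forall>s>0. (\<lambda>t. \<beta> s t) \<in> class_L)}"


subsection \<open>Input-to-state stability\<close>

text \<open>
  A system is the relation \<open>Sys u\<^sub>0 d f u\<close> saying that \<open>u\<close> is a trajectory with initial datum \<open>u\<^sub>0\<close>,
  boundary disturbance \<open>d\<close> and in-domain disturbance \<open>f\<close>.  The maxima over \<open>{0..t}\<close> and
  \<open>{0..1} \<times> {0..t}\<close> are written as suprema; they are attained for continuous \<open>d\<close> and \<open>f\<close>.
\<close>

type_synonym pde_system =
  "(real \<Rightarrow> real) \<Rightarrow> (real \<Rightarrow> real) \<Rightarrow> (real \<Rightarrow> real \<Rightarrow> real) \<Rightarrow> (real \<Rightarrow> real \<Rightarrow> real) \<Rightarrow> bool"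

definition ISS_L2_with ::
  "pde_system \<Rightarrow> (real \<Rightarrow> real \<Rightarrow> real) \<Rightarrow> (real \<Rightarrow> real) \<Rightarrow> (real \<Rightarrow> real) \<Rightarrow> bool" where
  "ISS_L2_with Sys \<beta> \<gamma>\<^sub>1 \<gamma>\<^sub>2 \<longleftrightarrow>
     \<beta> \<in> class_KL \<and> \<gamma>\<^sub>1 \<in> class_K \<and> \<gamma>\<^sub>2 \<in> class_K \<and>
     (\<forall>u\<^sub>0 d f u. Sys u\<^sub>0 d f u \<longrightarrow>
       (\<forall>t\<ge>0. L2_norm (\<lambda>x. u x t) \<le>
          \<beta> (L2_norm u\<^sub>0) t + \<gamma>\<^sub>1 (SUP s\<in>{0..t}. \<bar>d s\<bar>)
            + \<gamma>\<^sub>2 (SUP (x, s)\<in>{0..1} \<times> {0..t}. \<bar>f x s\<bar>)))"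

definition EISS_L2 :: "pde_system \<Rightarrow> bool" where
  "EISS_L2 Sys \<longleftrightarrow> (\<exists>\<beta> \<gamma>\<^sub>1 \<gamma>\<^sub>2. ISS_L2_with Sys \<beta> \<gamma>\<^sub>1 \<gamma>\<^sub>2 \<and>
     (\<exists>\<beta>' \<in> class_K_inf. \<exists>c>0. \<forall>r\<ge>0. \<forall>t\<ge>0. \<beta> r t \<le> \<beta>' r * exp (- (c * t))))"


subsection \<open>Burgers' equation\<close>

definition burgers_solution ::
  "real \<Rightarrow> real \<Rightarrow> (real \<Rightarrow> real) \<Rightarrow> (real \<Rightarrow> real) \<Rightarrow> (real \<Rightarrow> real \<Rightarrow> real) \<Rightarrow>
   (real \<Rightarrow> real \<Rightarrow> real) \<Rightarrow> bool" where
  "burgers_solution \<mu> \<nu> u\<^sub>0 d f u \<longleftrightarrow>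
     u \<in> C21 \<and>
     (\<forall>x\<in>{0<..<1}. \<forall>t>0. Dt u x t - \<mu> * Dx (Dx u) x t + \<nu> * u x t * Dx u x t = f x t) \<and>
     (\<forall>t\<ge>0. u 0 t = 0) \<and>
     (\<forall>t\<ge>0. u 1 t = d t) \<and>
     (\<forall>x\<in>{0..1}. u x 0 = u\<^sub>0 x)"

definition admissible_initial :: "real \<Rightarrow> (real \<Rightarrow> real) \<Rightarrow> bool" where
  "admissible_initial \<theta> u\<^sub>0 \<longleftrightarrow> u\<^sub>0 \<in> H_initial \<theta> \<and>
     u\<^sub>0 0 = 0 \<and> deriv_within (deriv_within u\<^sub>0 {0..1}) {0..1} 0 = 0 \<and>
     u\<^sub>0 1 = 0 \<and> deriv_within (deriv_within u\<^sub>0 {0..1}) {0..1} 1 = 0"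

definition admissible_disturbances ::
  "real \<Rightarrow> (real \<Rightarrow> real) \<Rightarrow> (real \<Rightarrow> real \<Rightarrow> real) \<Rightarrow> bool" where
  "admissible_disturbances \<theta> d f \<longleftrightarrow> d \<in> H_boundary \<theta> \<and> f \<in> H_parabolic \<theta> \<and>
     d 0 = 0 \<and> deriv_within d {0..} 0 = 0 \<and> f 0 0 = 0 \<and> f 1 0 = 0"

definition small_disturbances ::
  "real \<Rightarrow> real \<Rightarrow> (real \<Rightarrow> real) \<Rightarrow> (real \<Rightarrow> real \<Rightarrow> real) \<Rightarrow> bool" where
  "small_disturbances \<mu> \<nu> d f \<longleftrightarrow>
     (SUP s\<in>{0..}. \<bar>d s\<bar>) + 4 * sqrt 2 / \<mu> * (SUP (x, s)\<in>{0..1} \<times> {0..}. \<bar>f x s\<bar>) < \<mu> / \<nu>"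

definition burgers_system :: "real \<Rightarrow> real \<Rightarrow> real \<Rightarrow> pde_system" where
  "burgers_system \<mu> \<nu> \<theta> u\<^sub>0 d f u \<longleftrightarrow>
     admissible_initial \<theta> u\<^sub>0 \<and> admissible_disturbances \<theta> d f \<and> small_disturbances \<mu> \<nu> d f \<and>
     burgers_solution \<mu> \<nu> u\<^sub>0 d f u"

end

theory Submission
  imports Defs
begin

text \<open>
  The solution is trapped between two explicit functions of \<open>x\<close>, up to an excess that decays
  exponentially.  Let \<open>D\<close> and \<open>F\<close> bound \<open>\<bar>d\<bar>\<close> and \<open>\<bar>f\<bar>\<close> up to time \<open>T\<close>.  The increasing parabola
  \<open>a x = D + F / \<mu> * (x - x\<^sup>2 / 2)\<close> satisfies \<open>- \<mu> a'' + \<nu> a a' \<ge> F\<close> and dominates the boundary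
  data, so it is a steady supersolution.  Burgers' equation is invariant under
  \<open>u \<mapsto> - u, \<nu> \<mapsto> - \<nu>\<close>, so \<open>- b\<close> with the reflected parabola \<open>b x = a (1 - x)\<close> is a steady
  subsolution.  Both barriers have modulus at most \<open>M = D + F / (2 * \<mu>)\<close>.

  Testing the equation for \<open>z = u - a\<close> with the excess \<open>p = max 0 z\<close>, which vanishes at the end
  points, gives the decay of \<open>E t = \<integral> p\<^sup>2\<close>:
  the diffusion contributes at most \<open>- (2 / 3) * \<mu> * E\<close> to \<open>E' / 2\<close> by a Poincare inequality
  (\<open>dirichlet_bound_positive_part\<close>), and the convection has a favourable sign because
  \<open>p (u u\<^sub>x - a a\<^sub>x) = (p\<^sup>3 / 3 + a p\<^sup>2 / 2)\<^sub>x + a\<^sub>x p\<^sup>2 / 2\<close> and \<open>a\<close> increases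
  (\<open>convection_dissipates_excess\<close>).  Hence \<open>E' \<le> - \<mu> * E\<close> (\<open>excess_over_barrier_decays\<close>).

  Since \<open>\<bar>u\<bar> \<le> M + max p q\<close>, where \<open>q\<close> is the excess of \<open>- u\<close> over \<open>b\<close>, and since
  \<open>p\<^sup>2 + q\<^sup>2 \<le> u\<^sup>2\<close> at the initial time, the energy estimate (\<open>burgers_energy_estimate\<close>) follows with the
  constants \<open>2\<close>, \<open>4\<close> and \<open>1 / \<mu>\<^sup>2\<close>.  Square roots turn it into exponential input-to-state
  stability with linear gains.
\<close>

section \<open>The positive part and a differentiable approximation\<close>

lemma has_real_derivative_positive_part_power:
  fixes s :: real
  shows "((\<lambda>s. max 0 s ^ (n + 2)) has_real_derivative real (n + 2) * max 0 s ^ (n + 1)) (at s)"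
proof -
  consider "s < 0" | "s = 0" | "s > 0" by linarith
  then show ?thesis
  proof cases
    case 1
    have "((\<lambda>s. max 0 s ^ (n + 2)) has_real_derivative 0) (at s)"
      by (rule has_field_derivative_transform_within_open[where f = "\<lambda>_. 0" and S = "{..<0}"])
         (use 1 in auto)
    then show ?thesis using 1 by simp
  next
    case 2
    have eq: "max 0 h ^ (n + 1) = (max 0 (0 + h) ^ (n + 2) - max 0 0 ^ (n + 2)) / h"
      if "h \<noteq> 0" for h :: real
      using that by (cases "h > 0") auto
    have "((\<lambda>h. max 0 h ^ (n + 1)) \<longlongrightarrow> max 0 0 ^ (n + 1)) (at (0::real))"
      by (intro tendsto_intros)
    then have lim: "((\<lambda>h. (max 0 (0 + h) ^ (n + 2) - max 0 0 ^ (n + 2)) / h)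
        \<longlongrightarrow> max 0 0 ^ (n + 1)) (at (0::real))"
      by (rule LIM_equal[THEN iffD1, rotated]) (use eq in blast)
    have "((\<lambda>s. max 0 s ^ (n + 2)) has_real_derivative max 0 0 ^ (n + 1)) (at (0::real))"
      unfolding DERIV_def by (rule lim)
    then show ?thesis using 2 by simp
  next
    case 3
    have "((\<lambda>s. s ^ (n + 2)) has_real_derivative real (n + 2) * s ^ (n + 1)) (at s)"
      by (rule DERIV_cong[OF DERIV_power[OF DERIV_ident]]) simp
    then have "((\<lambda>s. max 0 s ^ (n + 2)) has_real_derivative real (n + 2) * s ^ (n + 1)) (at s)"
      by (rule has_field_derivative_transform_within_open[where S = "{0<..}"]) (use 3 in auto)
    then show ?thesis using 3 by simp
  qed
qed

text \<open>
  The positive part is not differentiable, which obstructs integration by parts.  This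
  \<open>C\<^sup>1\<close> approximation is a quotient of the differentiable powers of \<open>max 0 s\<close>.
\<close>

definition soft_positive_part :: "real \<Rightarrow> real \<Rightarrow> real" where
  "soft_positive_part \<delta> s = max 0 s ^ 3 / (max 0 s ^ 2 + \<delta>\<^sup>2)"

lemma soft_positive_part_bounds:
  assumes "\<delta> > 0"
  shows "0 \<le> soft_positive_part \<delta> s" "soft_positive_part \<delta> s \<le> max 0 s"
    "max 0 s - \<delta> \<le> soft_positive_part \<delta> s"
proof -
  define m where "m = max 0 s"
  have m: "m \<ge> 0" by (simp add: m_def)
  have pos: "m\<^sup>2 + \<delta>\<^sup>2 > 0" using assms by (simp add: add_nonneg_pos)
  show "0 \<le> soft_positive_part \<delta> s"
    unfolding soft_positive_part_def m_def[symmetric] using m pos by simp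
  have "0 \<le> m * \<delta>\<^sup>2" using m by simp
  then have "m ^ 3 \<le> m * (m\<^sup>2 + \<delta>\<^sup>2)"
    by (simp add: distrib_left power3_eq_cube power2_eq_square)
  then show "soft_positive_part \<delta> s \<le> max 0 s"
    unfolding soft_positive_part_def m_def[symmetric] using pos by (simp add: divide_le_eq)
  have "0 \<le> m * \<delta>" using m assms by simp
  then have "m * \<delta> \<le> m\<^sup>2 + \<delta>\<^sup>2"
    using sum_squares_bound[of m \<delta>] by linarith
  then have "\<delta> * (m * \<delta>) \<le> \<delta> * (m\<^sup>2 + \<delta>\<^sup>2)" using assms by (intro mult_left_mono) auto
  then have "(m - \<delta>) * (m\<^sup>2 + \<delta>\<^sup>2) \<le> m ^ 3"
    by (simp add: algebra_simps power3_eq_cube power2_eq_square)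
  then show "max 0 s - \<delta> \<le> soft_positive_part \<delta> s"
    unfolding soft_positive_part_def m_def[symmetric] using pos by (simp add: le_divide_eq)
qed

text \<open>
  A slope slightly above \<open>1\<close> is harmless: the Poincare inequality below starts from the constant
  \<open>3 / 4\<close> and only \<open>1 / 2\<close> has to survive.
\<close>

lemma soft_positive_part_derivative:
  assumes "\<delta> > 0"
  shows "\<exists>k. (soft_positive_part \<delta> has_real_derivative k) (at s) \<and> 0 \<le> k \<and> k \<le> 9 / 8"
proof -
  define m where "m = max 0 s"
  define k where "k = (m\<^sup>2 * (m\<^sup>2 + 3 * \<delta>\<^sup>2)) / (m\<^sup>2 + \<delta>\<^sup>2)\<^sup>2"
  have pos: "m\<^sup>2 + \<delta>\<^sup>2 > 0" using assms by (simp add: add_nonneg_pos)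
  have 3: "((\<lambda>s. max 0 s ^ 3) has_real_derivative 3 * m\<^sup>2) (at s)"
    using has_real_derivative_positive_part_power[of 1 s] by (simp add: m_def numeral_eq_Suc)
  have 2: "((\<lambda>s. max 0 s ^ 2) has_real_derivative 2 * m) (at s)"
    using has_real_derivative_positive_part_power[of 0 s] by (simp add: m_def numeral_eq_Suc)
  have "((\<lambda>s. max 0 s ^ 3 / (max 0 s ^ 2 + \<delta>\<^sup>2)) has_real_derivative
      (3 * m\<^sup>2 * (max 0 s ^ 2 + \<delta>\<^sup>2) - max 0 s ^ 3 * (2 * m + 0)) /
      ((max 0 s ^ 2 + \<delta>\<^sup>2) * (max 0 s ^ 2 + \<delta>\<^sup>2))) (at s)"
    by (intro DERIV_divide DERIV_add DERIV_const 2 3) (use pos in \<open>unfold m_def, linarith\<close>)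
  moreover have "3 * m\<^sup>2 * (m\<^sup>2 + \<delta>\<^sup>2) - m ^ 3 * (2 * m + 0) = m\<^sup>2 * (m\<^sup>2 + 3 * \<delta>\<^sup>2)"
    by (simp add: algebra_simps power2_eq_square power3_eq_cube)
  ultimately have "(soft_positive_part \<delta> has_real_derivative k) (at s)"
    unfolding soft_positive_part_def[abs_def] k_def m_def[symmetric]
    by (simp add: power2_eq_square[of "_ + _"])
  moreover have "0 \<le> k" unfolding k_def by simp
  moreover have "k \<le> 9 / 8"
  proof -
    have "0 \<le> (m\<^sup>2 - 3 * \<delta>\<^sup>2)\<^sup>2" by simp
    then have "8 * (m\<^sup>2 * (m\<^sup>2 + 3 * \<delta>\<^sup>2)) \<le> 9 * (m\<^sup>2 + \<delta>\<^sup>2)\<^sup>2"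
      by (simp add: algebra_simps power2_eq_square)
    then show ?thesis unfolding k_def using pos by (simp add: divide_le_eq)
  qed
  ultimately show ?thesis by blast
qed

section \<open>Dissipation of the truncated energy at a fixed time\<close>

text \<open>
  Integration by parts and a Poincare inequality in one step.  For \<open>h = soft_positive_part \<delta> (z x)\<close>
  the integrand is dominated by the derivative of the flux \<open>h z' + 8 / 9 * w h\<^sup>2\<close>, which vanishes at
  both end points.  The weight \<open>w x = x - 1 / 2\<close> is there for the Poincare inequality: completing
  the square in \<open>(h' + w h)\<^sup>2 \<ge> 0\<close> gives \<open>h'\<^sup>2 + (w h\<^sup>2)' \<ge> (w' - w\<^sup>2) h\<^sup>2\<close>, and
  \<open>w' - w\<^sup>2 \<ge> 3 / 4\<close> on the unit interval.
\<close>

lemma dirichlet_bound_soft_positive_part: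
  fixes z z' z'' :: "real \<Rightarrow> real"
  assumes z: "\<And>x. x \<in> {0..1} \<Longrightarrow> (z has_real_derivative z' x) (at x within {0..1})"
    and z': "\<And>x. x \<in> {0..1} \<Longrightarrow> (z' has_real_derivative z'' x) (at x within {0..1})"
    and z'': "continuous_on {0..1} z''"
    and bd: "z 0 \<le> 0" "z 1 \<le> 0" and \<delta>: "\<delta> > 0"
  shows "integral {0..1} (\<lambda>x. soft_positive_part \<delta> (z x) * z'' x
            + 2 / 3 * (soft_positive_part \<delta> (z x))\<^sup>2) \<le> 0"
proof -
  obtain k where k: "\<And>s. (soft_positive_part \<delta> has_real_derivative k s) (at s)"
      "\<And>s. 0 \<le> k s" "\<And>s. k s \<le> 9 / 8"
    using soft_positive_part_derivative[OF \<delta>] by metis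
  define h where "h x = soft_positive_part \<delta> (z x)" for x
  define w where "w x = x - 1 / 2" for x :: real
  define G where "G x = h x * z' x + 8 / 9 * (w x * (h x)\<^sup>2)" for x
  define g where "g x = h x * z'' x + k (z x) * (z' x)\<^sup>2
      + 8 / 9 * ((h x)\<^sup>2 + 2 * w x * h x * (k (z x) * z' x))" for x
  have h: "(h has_real_derivative k (z x) * z' x) (at x within {0..1})" if "x \<in> {0..1}" for x
    unfolding h_def by (rule DERIV_chain2[OF k(1) z[OF that]])
  have "(G has_real_derivative g x) (at x within {0..1})" if x: "x \<in> {0..1}" for x
    unfolding G_def[abs_def] g_def w_def
    by (auto intro!: derivative_eq_intros h[OF x] z'[OF x] simp: power2_eq_square algebra_simps)
  then have "(g has_integral G 1 - G 0) {0..1}"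
    by (intro fundamental_theorem_of_calculus)
       (auto simp: has_real_derivative_iff_has_vector_derivative)
  moreover have "h 0 = 0" "h 1 = 0"
    using bd by (auto simp: h_def soft_positive_part_def max_def)
  ultimately have g: "(g has_integral 0) {0..1}" by (simp add: G_def)
  have ch: "continuous_on {0..1} h"
    using h by (rule DERIV_continuous_on)
  have int: "(\<lambda>x. h x * z'' x + 2 / 3 * (h x)\<^sup>2) integrable_on {0..1}"
    by (intro integrable_continuous_interval continuous_intros ch z'')
  have "h x * z'' x + 2 / 3 * (h x)\<^sup>2 \<le> g x" if x: "x \<in> {0..1}" for x
  proof -
    define q where "q = k (z x) * z' x"
    have "q\<^sup>2 = k (z x) * (k (z x) * (z' x)\<^sup>2)" by (simp add: q_def power2_eq_square)
    also have "\<dots> \<le> 9 / 8 * (k (z x) * (z' x)\<^sup>2)" by (intro mult_right_mono k) (use k(2) in auto)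
    finally have 1: "8 / 9 * q\<^sup>2 \<le> k (z x) * (z' x)\<^sup>2" by simp
    have "0 \<le> (q + w x * h x)\<^sup>2" by simp
    then have 2: "- (w x)\<^sup>2 * (h x)\<^sup>2 \<le> q\<^sup>2 + 2 * w x * h x * q"
      by (simp add: power2_eq_square algebra_simps)
    have "\<bar>w x\<bar> \<le> 1 / 2" using x by (auto simp: w_def abs_if)
    then have "(w x)\<^sup>2 \<le> (1 / 2)\<^sup>2" by (metis abs_ge_zero power2_abs power_mono)
    then have "(w x)\<^sup>2 * (h x)\<^sup>2 \<le> 1 / 4 * (h x)\<^sup>2"
      by (intro mult_right_mono) (auto simp: power2_eq_square)
    with 1 2 show ?thesis unfolding g_def q_def[symmetric] by (simp add: algebra_simps)
  qed
  then have "integral {0..1} (\<lambda>x. h x * z'' x + 2 / 3 * (h x)\<^sup>2) \<le> 0"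
    by (intro has_integral_le[OF integrable_integral[OF int] g])
  then show ?thesis by (simp add: h_def)
qed

text \<open>
  The previous bound passes to the limit \<open>\<delta> \<longlongrightarrow> 0\<close> because the approximation differs from the
  positive part by at most \<open>\<delta>\<close>, uniformly.
\<close>

lemma dirichlet_bound_positive_part:
  fixes z z' z'' :: "real \<Rightarrow> real"
  assumes z: "\<And>x. x \<in> {0..1} \<Longrightarrow> (z has_real_derivative z' x) (at x within {0..1})"
    and z': "\<And>x. x \<in> {0..1} \<Longrightarrow> (z' has_real_derivative z'' x) (at x within {0..1})"
    and z'': "continuous_on {0..1} z''"
    and bd: "z 0 \<le> 0" "z 1 \<le> 0"
  shows "integral {0..1} (\<lambda>x. max 0 (z x) * z'' x) \<le> - (2 / 3) * integral {0..1} (\<lambda>x. (max 0 (z x))\<^sup>2)"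
proof -
  define m where "m x = max 0 (z x)" for x
  have cz: "continuous_on {0..1} z"
    using z by (rule DERIV_continuous_on)
  then have cm: "continuous_on {0..1} m" unfolding m_def by (intro continuous_intros)
  define K where "K = integral {0..1} (\<lambda>x. \<bar>z'' x\<bar> + 4 / 3 * m x)"
  have step: "integral {0..1} (\<lambda>x. m x * z'' x + 2 / 3 * (m x)\<^sup>2) \<le> \<delta> * K" if \<delta>: "\<delta> > 0" for \<delta>
  proof -
    obtain k where k: "\<And>s. (soft_positive_part \<delta> has_real_derivative k s) (at s)"
      using soft_positive_part_derivative[OF \<delta>] by metis
    have cS: "continuous_on UNIV (soft_positive_part \<delta>)"
      using k by (rule DERIV_continuous_on)
    define h where "h x = soft_positive_part \<delta> (z x)" for x
    have ch: "continuous_on {0..1} h"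
      unfolding h_def using continuous_on_compose2[OF cS cz] by simp
    have hb: "0 \<le> h x" "h x \<le> m x" "m x - \<delta> \<le> h x" for x
      using soft_positive_part_bounds[OF \<delta>] by (auto simp: h_def m_def)
    have "integral {0..1} (\<lambda>x. m x * z'' x + 2 / 3 * (m x)\<^sup>2)
        \<le> integral {0..1} (\<lambda>x. (h x * z'' x + 2 / 3 * (h x)\<^sup>2) + \<delta> * (\<bar>z'' x\<bar> + 4 / 3 * m x))"
    proof (intro integral_le integrable_continuous_interval continuous_intros cm ch z'')
      fix x :: real
      have "(m x - h x) * z'' x \<le> (m x - h x) * \<bar>z'' x\<bar>" using hb[of x] by (intro mult_left_mono) auto
      also have "\<dots> \<le> \<delta> * \<bar>z'' x\<bar>" using hb(3)[of x] by (intro mult_right_mono) auto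
      finally have 1: "m x * z'' x \<le> h x * z'' x + \<delta> * \<bar>z'' x\<bar>" by (simp add: algebra_simps)
      have "(m x - h x) * (m x + h x) \<le> \<delta> * (2 * m x)"
        using hb[of x] \<delta> by (intro mult_mono) auto
      then have "(m x)\<^sup>2 \<le> (h x)\<^sup>2 + \<delta> * (2 * m x)" by (simp add: algebra_simps power2_eq_square)
      with 1 show "m x * z'' x + 2 / 3 * (m x)\<^sup>2
          \<le> h x * z'' x + 2 / 3 * (h x)\<^sup>2 + \<delta> * (\<bar>z'' x\<bar> + 4 / 3 * m x)"
        by (simp add: algebra_simps)
    qed
    also have "\<dots> = integral {0..1} (\<lambda>x. h x * z'' x + 2 / 3 * (h x)\<^sup>2) + \<delta> * K"
      unfolding K_def integral_mult_right[symmetric]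
      by (intro integral_add integrable_continuous_interval continuous_intros cm ch z'')
    also have "\<dots> \<le> \<delta> * K"
      using dirichlet_bound_soft_positive_part[OF z z' z'' bd \<delta>] by (simp add: h_def)
    finally show ?thesis .
  qed
  have "integral {0..1} (\<lambda>x. m x * z'' x + 2 / 3 * (m x)\<^sup>2) \<le> 0"
  proof (rule tendsto_lowerbound[where F = "at_right 0" and f = "\<lambda>\<delta>. \<delta> * K"])
    have "((\<lambda>\<delta>. \<delta> * K) \<longlongrightarrow> 0 * K) (at_right 0)" by (intro tendsto_intros)
    then show "((\<lambda>\<delta>. \<delta> * K) \<longlongrightarrow> 0) (at_right 0)" by simp
    show "\<forall>\<^sub>F \<delta> in at_right 0. integral {0..1} (\<lambda>x. m x * z'' x + 2 / 3 * (m x)\<^sup>2) \<le> \<delta> * K"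
      using step by (auto simp: eventually_at_right_field intro!: exI[of _ 1])
  qed simp
  also have "integral {0..1} (\<lambda>x. m x * z'' x + 2 / 3 * (m x)\<^sup>2)
      = integral {0..1} (\<lambda>x. m x * z'' x) + 2 / 3 * integral {0..1} (\<lambda>x. (m x)\<^sup>2)"
    unfolding integral_mult_right[symmetric]
    by (intro integral_add integrable_continuous_interval continuous_intros cm z'')
  finally show ?thesis unfolding m_def by simp
qed

text \<open>
  With \<open>p = max 0 (v - \<phi>)\<close>, the integrand equals the derivative of
  \<open>\<nu> * (p\<^sup>3 / 3 + \<phi> * p\<^sup>2 / 2)\<close>, which integrates to zero, plus \<open>\<nu> * \<phi>' * (p\<^sup>2 / 2 + \<phi> * p)\<close>.
  The sign of \<open>\<nu>\<close> is left open so that the lemma also serves \<open>- u\<close>, which solves the equation with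
  \<open>- \<nu>\<close>.
\<close>

lemma convection_dissipates_excess:
  fixes v v' \<phi> \<phi>' :: "real \<Rightarrow> real"
  assumes v: "\<And>x. x \<in> {0..1} \<Longrightarrow> (v has_real_derivative v' x) (at x within {0..1})"
    and \<phi>: "\<And>x. x \<in> {0..1} \<Longrightarrow> (\<phi> has_real_derivative \<phi>' x) (at x within {0..1})"
    and v': "continuous_on {0..1} v'"
    and bd: "v 0 \<le> \<phi> 0" "v 1 \<le> \<phi> 1"
    and \<phi>_nonneg: "\<And>x. x \<in> {0..1} \<Longrightarrow> 0 \<le> \<phi> x"
    and mono: "\<And>x. x \<in> {0..1} \<Longrightarrow> 0 \<le> \<nu> * \<phi>' x"
  shows "0 \<le> integral {0..1} (\<lambda>x. max 0 (v x - \<phi> x) * (\<nu> * v x * v' x))"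
proof -
  define p where "p x = max 0 (v x - \<phi> x)" for x
  define G where "G x = \<nu> * (p x ^ 3 / 3 + \<phi> x * (p x)\<^sup>2 / 2)" for x
  define g where "g x = \<nu> * ((p x)\<^sup>2 * (v' x - \<phi>' x) + \<phi>' x * (p x)\<^sup>2 / 2
      + \<phi> x * p x * (v' x - \<phi>' x))" for x
  have cv: "continuous_on {0..1} v" and c\<phi>: "continuous_on {0..1} \<phi>"
    by (rule DERIV_continuous_on, erule v) (rule DERIV_continuous_on, erule \<phi>)
  have cp: "continuous_on {0..1} p" unfolding p_def by (intro continuous_intros cv c\<phi>)
  have "(G has_real_derivative g x) (at x within {0..1})" if x: "x \<in> {0..1}" for x
  proof -
    have z: "((\<lambda>x. v x - \<phi> x) has_real_derivative v' x - \<phi>' x) (at x within {0..1})"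
      by (intro DERIV_diff v \<phi> x)
    have p3: "((\<lambda>x. p x ^ 3) has_real_derivative 3 * (p x)\<^sup>2 * (v' x - \<phi>' x)) (at x within {0..1})"
      using DERIV_chain2[OF has_real_derivative_positive_part_power[of 1] z]
      by (simp add: p_def numeral_eq_Suc)
    have p2: "((\<lambda>x. (p x)\<^sup>2) has_real_derivative 2 * p x * (v' x - \<phi>' x)) (at x within {0..1})"
      using DERIV_chain2[OF has_real_derivative_positive_part_power[of 0] z]
      by (simp add: p_def numeral_eq_Suc)
    show ?thesis
      unfolding G_def[abs_def] g_def
      by (rule DERIV_cong[OF DERIV_cmult[OF DERIV_add[OF DERIV_cdivide[OF p3]
              DERIV_cdivide[OF DERIV_mult[OF \<phi>[OF x] p2]]]]])
         (simp add: field_simps)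
  qed
  then have "(g has_integral G 1 - G 0) {0..1}"
    by (intro fundamental_theorem_of_calculus)
       (auto simp: has_real_derivative_iff_has_vector_derivative)
  moreover have "G 0 = 0" "G 1 = 0" using bd by (auto simp: G_def p_def max_def)
  ultimately have g: "(g has_integral 0) {0..1}" by simp
  have int: "(\<lambda>x. p x * (\<nu> * v x * v' x)) integrable_on {0..1}"
    by (intro integrable_continuous_interval continuous_intros cv cp v')
  have "g x \<le> p x * (\<nu> * v x * v' x)" if x: "x \<in> {0..1}" for x
  proof (cases "p x = 0")
    case True
    then show ?thesis by (simp add: g_def)
  next
    case False
    then have v_eq: "v x = p x + \<phi> x" and p: "p x > 0" by (auto simp: p_def max_def split: if_splits)
    have "0 \<le> (\<nu> * \<phi>' x) * ((p x)\<^sup>2 / 2 + p x * \<phi> x)"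
      using p \<phi>_nonneg[OF x] by (intro mult_nonneg_nonneg[OF mono[OF x]]) auto
    also have "\<dots> = p x * (\<nu> * v x * v' x) - g x"
      unfolding g_def v_eq by (simp add: algebra_simps power2_eq_square)
    finally show ?thesis by simp
  qed
  then have "0 \<le> integral {0..1} (\<lambda>x. p x * (\<nu> * v x * v' x))"
    by (intro has_integral_le[OF g integrable_integral[OF int]])
  then show ?thesis by (simp add: p_def)
qed


section \<open>Exponential decay of the excess over a barrier\<close>

text \<open>
  The barrier has \<open>\<mu> * \<phi>'' = - F\<close>, so the source is absorbed into the diffusion of \<open>v - \<phi>\<close>.  The two
  preceding lemmas then bound the derivative of the truncated energy, and Gronwall's argument
  concludes.
\<close>

lemma excess_over_barrier_decays:
  fixes v vx vxx vt :: "real \<Rightarrow> real \<Rightarrow> real" and \<phi> \<phi>' :: "real \<Rightarrow> real"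
  assumes \<mu>: "0 < \<mu>" and T: "0 \<le> T"
    and vx: "\<And>x t. x \<in> {0..1} \<Longrightarrow> 0 \<le> t \<Longrightarrow> ((\<lambda>x. v x t) has_real_derivative vx x t) (at x within {0..1})"
    and vxx: "\<And>x t. x \<in> {0..1} \<Longrightarrow> 0 \<le> t \<Longrightarrow> ((\<lambda>x. vx x t) has_real_derivative vxx x t) (at x within {0..1})"
    and vt: "\<And>x t. x \<in> {0..1} \<Longrightarrow> 0 \<le> t \<Longrightarrow> (v x has_real_derivative vt x t) (at t within {0..})"
    and cv: "continuous_on ({0..1} \<times> {0..}) (\<lambda>(x, t). v x t)"
    and cvxx: "continuous_on ({0..1} \<times> {0..}) (\<lambda>(x, t). vxx x t)"
    and cvt: "continuous_on ({0..1} \<times> {0..}) (\<lambda>(x, t). vt x t)"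
    and pde: "\<And>x t. x \<in> {0<..<1} \<Longrightarrow> t \<in> {0<..<T} \<Longrightarrow>
        vt x t - \<mu> * vxx x t + \<nu> * v x t * vx x t \<le> F"
    and \<phi>: "\<And>x. x \<in> {0..1} \<Longrightarrow> (\<phi> has_real_derivative \<phi>' x) (at x within {0..1})"
    and \<phi>': "\<And>x. x \<in> {0..1} \<Longrightarrow> (\<phi>' has_real_derivative - F / \<mu>) (at x within {0..1})"
    and \<phi>_nonneg: "\<And>x. x \<in> {0..1} \<Longrightarrow> 0 \<le> \<phi> x"
    and mono: "\<And>x. x \<in> {0..1} \<Longrightarrow> 0 \<le> \<nu> * \<phi>' x"
    and bd: "\<And>t. t \<in> {0<..<T} \<Longrightarrow> v 0 t \<le> \<phi> 0" "\<And>t. t \<in> {0<..<T} \<Longrightarrow> v 1 t \<le> \<phi> 1"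
  shows "integral {0..1} (\<lambda>x. (max 0 (v x T - \<phi> x))\<^sup>2)
    \<le> exp (- (\<mu> * T)) * integral {0..1} (\<lambda>x. (max 0 (v x 0 - \<phi> x))\<^sup>2)"
proof -
  define p where "p t x = max 0 (v x t - \<phi> x)" for t x
  define E where "E t = integral {0..1} (\<lambda>x. (p t x)\<^sup>2)" for t
  define E' where "E' t = integral {0..1} (\<lambda>x. 2 * p t x * vt x t)" for t
  have c\<phi>: "continuous_on {0..1} \<phi>" using \<phi> by (rule DERIV_continuous_on)
  have swap: "continuous_on ({0..} \<times> {0..1}) (\<lambda>(t, x). w x t)"
    if "continuous_on ({0..1} \<times> {0..}) (\<lambda>(x, t). w x t)" for w :: "real \<Rightarrow> real \<Rightarrow> real"
    using continuous_on_compose2[OF that continuous_on_swap[of "{0..} \<times> {0..1}"]]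
    by (force simp: case_prod_beta)
  have slice: "continuous_on {0..1} (\<lambda>x. w x t)"
    if "continuous_on ({0..1} \<times> {0..}) (\<lambda>(x, t). w x t)" "0 \<le> t" for w :: "real \<Rightarrow> real \<Rightarrow> real" and t
    using continuous_on_compose2[OF that(1) continuous_on_Pair[OF continuous_on_id continuous_on_const[of _ t]], of "{0..1}"] that(2)
    by auto
  have cp: "continuous_on {0..1} (p t)" if "0 \<le> t" for t
    unfolding p_def by (intro continuous_intros slice cv that c\<phi>)
  have E_deriv: "(E has_real_derivative E' t) (at t within {0..})" if t: "0 \<le> t" for t
    unfolding E_def[abs_def] E'_def box_real(2)[symmetric]
  proof (rule leibniz_rule_field_derivative)
    fix s x :: real assume "s \<in> {0..}" "x \<in> cbox 0 1"
    then have z: "((\<lambda>s. v x s - \<phi> x) has_real_derivative vt x s) (at s within {0..})"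
      by (auto intro!: derivative_eq_intros vt)
    show "((\<lambda>s. (p s x)\<^sup>2) has_real_derivative 2 * p s x * vt x s) (at s within {0..})"
      using DERIV_chain2[OF has_real_derivative_positive_part_power[of 0] z]
      by (simp add: p_def numeral_eq_Suc)
  next
    fix s :: real assume "s \<in> {0..}"
    then show "(\<lambda>x. (p s x)\<^sup>2) integrable_on cbox 0 1"
      by (intro integrable_continuous continuous_intros) (use cp in auto)
  next
    have "continuous_on ({0..} \<times> {0..1}) (\<lambda>z. 2 * max 0 ((\<lambda>(t, x). v x t) z - \<phi> (snd z)) * (\<lambda>(t, x). vt x t) z)"
      by (intro continuous_intros swap cv cvt continuous_on_compose2[OF c\<phi>]) auto
    then show "continuous_on ({0..} \<times> cbox 0 1) (\<lambda>(s, x). 2 * p s x * vt x s)"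
      by (simp add: p_def case_prod_beta)
  qed (use t in auto)
  have decay: "E' t \<le> - \<mu> * E t" if t: "t \<in> {0<..<T}" for t
  proof -
    have t0: "0 \<le> t" using t by simp
    have cvx: "continuous_on {0..1} (\<lambda>x. vx x t)"
      using vxx[OF _ t0] by (rule DERIV_continuous_on)
    note cont = cp[OF t0] slice[OF cv t0] slice[OF cvxx t0] slice[OF cvt t0] cvx
    have "E' t \<le> integral {0..1} (\<lambda>x. 2 * \<mu> * (p t x * (vxx x t - - F / \<mu>))
        - 2 * (p t x * (\<nu> * v x t * vx x t)))"
      unfolding E'_def integral_open_interval_real
    proof (intro integral_le)
      fix x :: real assume x: "x \<in> {0<..<1}"
      have "2 * p t x * vt x t \<le> 2 * p t x * (\<mu> * vxx x t - \<nu> * v x t * vx x t + F)"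
        using pde[OF x t] by (intro mult_left_mono) (auto simp: p_def)
      also have "\<dots> = 2 * \<mu> * (p t x * (vxx x t - - F / \<mu>)) - 2 * (p t x * (\<nu> * v x t * vx x t))"
        using \<mu> by (simp add: field_simps)
      finally show "2 * p t x * vt x t
        \<le> 2 * \<mu> * (p t x * (vxx x t - - F / \<mu>)) - 2 * (p t x * (\<nu> * v x t * vx x t))" .
    qed (auto simp only: integrable_on_open_interval_real
          intro!: integrable_continuous_interval continuous_intros cont)
    (* The diffusion term is now the second derivative of the difference v - phi. *)
    also have "\<dots> = 2 * \<mu> * integral {0..1} (\<lambda>x. p t x * (vxx x t - - F / \<mu>))
        - 2 * integral {0..1} (\<lambda>x. p t x * (\<nu> * v x t * vx x t))"
      unfolding integral_mult_right[symmetric]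
      by (intro integral_diff integrable_continuous_interval continuous_intros cont)
    also have "\<dots> \<le> 2 * \<mu> * (- (2 / 3) * E t) - 2 * 0"
    proof (intro diff_mono mult_left_mono)
      show "integral {0..1} (\<lambda>x. p t x * (vxx x t - - F / \<mu>)) \<le> - (2 / 3) * E t"
        unfolding E_def p_def
      proof (rule dirichlet_bound_positive_part)
        show "((\<lambda>x. v x t - \<phi> x) has_real_derivative vx x t - \<phi>' x) (at x within {0..1})"
          if "x \<in> {0..1}" for x
          using that t0 by (intro DERIV_diff vx \<phi>)
        show "((\<lambda>x. vx x t - \<phi>' x) has_real_derivative vxx x t - - F / \<mu>) (at x within {0..1})"
          if "x \<in> {0..1}" for x
          using that t0 by (intro DERIV_diff vxx \<phi>')
        show "continuous_on {0..1} (\<lambda>x. vxx x t - - F / \<mu>)"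
          by (intro continuous_intros cont)
        show "v 0 t - \<phi> 0 \<le> 0" "v 1 t - \<phi> 1 \<le> 0" using bd[OF t] by auto
      qed
      show "0 \<le> integral {0..1} (\<lambda>x. p t x * (\<nu> * v x t * vx x t))"
        unfolding p_def using bd[OF t]
        by (intro convection_dissipates_excess[OF vx[OF _ t0] \<phi> cvx _ _ \<phi>_nonneg mono])
    qed (use \<mu> in auto)
    also have "\<dots> \<le> - \<mu> * E t"
      using \<mu> by (auto simp: E_def intro!: integral_nonneg integrable_continuous_interval continuous_intros cont)
    finally show ?thesis .
  qed
  have "exp (\<mu> * 0) * E 0 \<ge> exp (\<mu> * T) * E T"
  proof (rule DERIV_nonpos_imp_decreasing_open[OF T])
    fix t assume t: "0 < t" "t < T"
    then have "(E has_real_derivative E' t) (at t)"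
      using E_deriv[of t] by (simp add: at_within_interior[of t "{0..}"] interior_real_atLeast)
    then have "((\<lambda>t. exp (\<mu> * t) * E t) has_real_derivative exp (\<mu> * t) * (\<mu> * E t + E' t)) (at t)"
      by (auto intro!: derivative_eq_intros simp: algebra_simps)
    moreover have "exp (\<mu> * t) * (\<mu> * E t + E' t) \<le> 0"
      using decay[of t] t by (intro mult_nonneg_nonpos) auto
    ultimately show "\<exists>y. ((\<lambda>t. exp (\<mu> * t) * E t) has_real_derivative y) (at t) \<and> y \<le> 0" by blast
  next
    have "continuous_on {0..} E" by (rule DERIV_continuous_on) (use E_deriv in auto)
    then show "continuous_on {0..T} (\<lambda>t. exp (\<mu> * t) * E t)"
      by (intro continuous_intros) (auto elim: continuous_on_subset)
  qed
  then have "exp (- (\<mu> * T)) * (exp (\<mu> * T) * E T) \<le> exp (- (\<mu> * T)) * E 0"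
    by (intro mult_left_mono) auto
  then show ?thesis by (simp add: E_def p_def exp_minus field_simps)
qed


section \<open>The energy estimate\<close>

lemma L2_norm_power2_eq_integral:
  assumes "continuous_on {0..1} g"
  shows "(L2_norm g)\<^sup>2 = integral {0..1} (\<lambda>x. (g x)\<^sup>2)"
proof -
  have "set_integrable lborel {0..1} (\<lambda>x. (g x)\<^sup>2)"
    unfolding set_integrable_def
    by (rule borel_integrable_compact) (auto intro!: continuous_intros assms)
  then have "set_integrable lborel {0<..<1} (\<lambda>x. (g x)\<^sup>2)"
    by (rule set_integrable_subset) auto
  then have "(LBINT x:{0<..<1}. (g x)\<^sup>2) = integral {0<..<1} (\<lambda>x. (g x)\<^sup>2)"
    by (rule set_borel_integral_eq_integral)
  also have "\<dots> = integral {0..1} (\<lambda>x. (g x)\<^sup>2)" by (simp add: integral_open_interval_real)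
  finally have "(LBINT x:{0<..<1}. (g x)\<^sup>2) = integral {0..1} (\<lambda>x. (g x)\<^sup>2)" .
  moreover have "0 \<le> integral {0..1} (\<lambda>x. (g x)\<^sup>2)"
    by (intro integral_nonneg integrable_continuous_interval continuous_intros assms) auto
  ultimately show ?thesis by (simp add: L2_norm_def)
qed

lemma C21_has_derivatives:
  assumes "u \<in> C21" "x \<in> {0..1}" "0 \<le> t"
  shows "((\<lambda>x. u x t) has_real_derivative Dx u x t) (at x within {0..1})"
    "((\<lambda>x. Dx u x t) has_real_derivative Dx (Dx u) x t) (at x within {0..1})"
    "(u x has_real_derivative Dt u x t) (at t within {0..})"
proof -
  have *: "(g has_real_derivative deriv_within g S y) (at y within S)"
    if "g differentiable_on S" "y \<in> S" for g S y
    using that vector_derivative_works[of g "at y within S"]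
    by (auto simp: differentiable_on_def deriv_within_def has_real_derivative_iff_has_vector_derivative)
  show "((\<lambda>x. u x t) has_real_derivative Dx u x t) (at x within {0..1})"
    "((\<lambda>x. Dx u x t) has_real_derivative Dx (Dx u) x t) (at x within {0..1})"
    "(u x has_real_derivative Dt u x t) (at t within {0..})"
    using assms *[of "\<lambda>x. u x t" "{0..1}" x] *[of "\<lambda>x. Dx u x t" "{0..1}" x] *[of "u x" "{0..}" t]
    by (auto simp: C21_def Dx_def[of u x] Dx_def[of "Dx u"] Dt_def)
qed

text \<open>
  Both excesses are needed since the sign of \<open>s\<close> decides which barrier is active; the cost of
  splitting the square is the factor \<open>2\<close>.
\<close>

lemma power2_le_of_two_sided_excess:
  fixes s M a b :: real
  assumes "0 \<le> a" "a \<le> M" "0 \<le> b" "b \<le> M"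
  shows "s\<^sup>2 \<le> 2 * M\<^sup>2 + (2 * (max 0 (s - a))\<^sup>2 + 2 * (max 0 (- s - b))\<^sup>2)"
proof -
  define m where "m = max (max 0 (s - a)) (max 0 (- s - b))"
  have "\<bar>s\<bar> \<le> M + m" using assms by (auto simp: m_def)
  then have "s\<^sup>2 \<le> (M + m)\<^sup>2" by (metis abs_ge_zero power2_abs power_mono)
  also have "\<dots> \<le> 2 * M\<^sup>2 + 2 * m\<^sup>2"
    using sum_squares_bound[of M m] by (simp add: power2_sum)
  also have "m\<^sup>2 \<le> (max 0 (s - a))\<^sup>2 + (max 0 (- s - b))\<^sup>2" by (auto simp: m_def max_def)
  finally show ?thesis by simp
qed

lemma two_sided_excess_le_power2:
  fixes s a b :: real
  assumes "0 \<le> a" "0 \<le> b"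
  shows "(max 0 (s - a))\<^sup>2 + (max 0 (- s - b))\<^sup>2 \<le> s\<^sup>2"
proof (cases "s \<ge> 0")
  case True
  then have "(max 0 (s - a))\<^sup>2 \<le> s\<^sup>2" "max 0 (- s - b) = 0"
    using assms by (auto intro!: power_mono)
  then show ?thesis by simp
next
  case False
  then have "(max 0 (- s - b))\<^sup>2 \<le> (- s)\<^sup>2" using assms by (intro power_mono) auto
  moreover have "max 0 (s - a) = 0" using assms False by simp
  ultimately show ?thesis by simp
qed

text \<open>
  The upper barrier \<open>a\<close> increases and the barrier \<open>b\<close> for \<open>- u\<close> decreases, because the sign of \<open>\<nu>\<close>
  changes with that of \<open>u\<close>; both have second derivative \<open>- F / \<mu>\<close> and lie between \<open>D\<close> and \<open>M\<close>.
\<close>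

lemma burgers_energy_estimate:
  fixes u :: "real \<Rightarrow> real \<Rightarrow> real"
  assumes \<mu>: "0 < \<mu>" and \<nu>: "0 \<le> \<nu>" and T: "0 \<le> T"
    and sol: "burgers_solution \<mu> \<nu> u\<^sub>0 d f u"
    and d: "\<And>s. s \<in> {0..T} \<Longrightarrow> \<bar>d s\<bar> \<le> D"
    and f: "\<And>x s. x \<in> {0..1} \<Longrightarrow> s \<in> {0..T} \<Longrightarrow> \<bar>f x s\<bar> \<le> F"
  shows "(L2_norm (\<lambda>x. u x T))\<^sup>2
    \<le> 2 * (L2_norm u\<^sub>0)\<^sup>2 * exp (- (\<mu> * T)) + 4 * D\<^sup>2 + F\<^sup>2 / \<mu>\<^sup>2"
proof -
  have D: "0 \<le> D" using d[of 0] T by simp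
  have F: "0 \<le> F" using f[of 0 0] T by simp
  have C: "u \<in> C21"
    and pde: "\<And>x t. x \<in> {0<..<1} \<Longrightarrow> 0 < t \<Longrightarrow>
      Dt u x t - \<mu> * Dx (Dx u) x t + \<nu> * u x t * Dx u x t = f x t"
    and bd: "\<And>t. 0 \<le> t \<Longrightarrow> u 0 t = 0" "\<And>t. 0 \<le> t \<Longrightarrow> u 1 t = d t"
    and init: "\<And>x. x \<in> {0..1} \<Longrightarrow> u x 0 = u\<^sub>0 x"
    using sol by (auto simp: burgers_solution_def)
  have cont: "continuous_on ({0..1} \<times> {0..}) (\<lambda>(x, t). u x t)"
    "continuous_on ({0..1} \<times> {0..}) (\<lambda>(x, t). Dx (Dx u) x t)"
    "continuous_on ({0..1} \<times> {0..}) (\<lambda>(x, t). Dt u x t)"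
    using C by (auto simp: C21_def)
  have cu: "continuous_on {0..1} (\<lambda>x. u x t)" if "0 \<le> t" for t
    by (rule DERIV_continuous_on) (rule C21_has_derivatives[OF C _ that])
  define a where "a x = D + F / \<mu> * (x - x\<^sup>2 / 2)" for x
  define b where "b x = D + F / \<mu> * ((1 - x\<^sup>2) / 2)" for x
  define M where "M = D + F / (2 * \<mu>)"
  have quad: "0 \<le> x - x\<^sup>2 / 2" "x - x\<^sup>2 / 2 \<le> 1 / 2" "0 \<le> (1 - x\<^sup>2) / 2" "(1 - x\<^sup>2) / 2 \<le> 1 / 2"
    if "x \<in> {0..1}" for x :: real
  proof -
    have "0 \<le> (1 - x)\<^sup>2" "x\<^sup>2 \<le> x" using that by (auto simp: power2_eq_square mult_left_le)
    then show "0 \<le> x - x\<^sup>2 / 2" "x - x\<^sup>2 / 2 \<le> 1 / 2" "0 \<le> (1 - x\<^sup>2) / 2" "(1 - x\<^sup>2) / 2 \<le> 1 / 2"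
      using that by (auto simp: power2_eq_square algebra_simps)
  qed
  have F\<mu>: "0 \<le> F / \<mu>" and M: "M = D + F / \<mu> * (1 / 2)" using F \<mu> by (simp_all add: M_def)
  have ab: "D \<le> a x" "a x \<le> M" "D \<le> b x" "b x \<le> M" if "x \<in> {0..1}" for x
    unfolding a_def b_def M le_add_same_cancel1 add_le_cancel_left
    using quad[OF that] by (auto intro: mult_nonneg_nonneg[OF F\<mu>] mult_left_mono[OF _ F\<mu>] simp only:)
  have ca: "continuous_on {0..1} a" and cb: "continuous_on {0..1} b"
    unfolding a_def b_def using \<mu> by (auto intro!: continuous_intros)
  define p where "p t x = max 0 (u x t - a x)" for t x
  define q where "q t x = max 0 (- u x t - b x)" for t x
  have cp: "continuous_on {0..1} (p t)" and cq: "continuous_on {0..1} (q t)" if "0 \<le> t" for t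
    unfolding p_def q_def by (intro continuous_intros cu that ca cb)+
  note cpq = cp[OF T] cq[OF T] cp[OF order_refl] cq[OF order_refl] cu[OF order_refl] cu[OF T]
  have p_decay: "integral {0..1} (\<lambda>x. (p T x)\<^sup>2) \<le> exp (- (\<mu> * T)) * integral {0..1} (\<lambda>x. (p 0 x)\<^sup>2)"
    unfolding p_def
  proof (rule excess_over_barrier_decays[where vx = "Dx u" and vxx = "Dx (Dx u)" and vt = "Dt u"
        and \<nu> = \<nu> and F = F and \<phi>' = "\<lambda>x. F / \<mu> * (1 - x)"])
    show "Dt u x t - \<mu> * Dx (Dx u) x t + \<nu> * u x t * Dx u x t \<le> F"
      if "x \<in> {0<..<1}" "t \<in> {0<..<T}" for x t
      using pde[OF that(1), of t] f[of x t] that by auto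
    show "u 0 t \<le> a 0" "u 1 t \<le> a 1" if "t \<in> {0<..<T}" for t
      using bd[of t] d[of t] ab(1)[of 0] ab(1)[of 1] D that by auto
    show "(a has_real_derivative F / \<mu> * (1 - x)) (at x within {0..1})" for x
      unfolding a_def using \<mu> by (auto intro!: derivative_eq_intros)
    show "((\<lambda>x. F / \<mu> * (1 - x)) has_real_derivative - F / \<mu>) (at x within {0..1})" for x
      using \<mu> by (auto intro!: derivative_eq_intros)
    show "0 \<le> a x" "0 \<le> \<nu> * (F / \<mu> * (1 - x))" if "x \<in> {0..1}" for x
      using ab(1)[OF that] D F \<mu> \<nu> that by auto
  qed (use \<mu> T C21_has_derivatives[OF C] cont in auto)
  have q_decay: "integral {0..1} (\<lambda>x. (q T x)\<^sup>2) \<le> exp (- (\<mu> * T)) * integral {0..1} (\<lambda>x. (q 0 x)\<^sup>2)"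
    unfolding q_def
  proof (rule excess_over_barrier_decays[where v = "\<lambda>x t. - u x t" and vx = "\<lambda>x t. - Dx u x t"
        and vxx = "\<lambda>x t. - Dx (Dx u) x t" and vt = "\<lambda>x t. - Dt u x t"
        and \<nu> = "- \<nu>" and F = F and \<phi>' = "\<lambda>x. F / \<mu> * (- x)"])
    show "- Dt u x t - \<mu> * - Dx (Dx u) x t + - \<nu> * - u x t * - Dx u x t \<le> F"
      if "x \<in> {0<..<1}" "t \<in> {0<..<T}" for x t
      using pde[OF that(1), of t] f[of x t] that by auto
    show "- u 0 t \<le> b 0" "- u 1 t \<le> b 1" if "t \<in> {0<..<T}" for t
      using bd[of t] d[of t] ab(3)[of 0] ab(3)[of 1] D that by auto
    show "(b has_real_derivative F / \<mu> * (- x)) (at x within {0..1})" for x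
      unfolding b_def using \<mu> by (auto intro!: derivative_eq_intros)
    show "((\<lambda>x. F / \<mu> * (- x)) has_real_derivative - F / \<mu>) (at x within {0..1})" for x
      using \<mu> by (auto intro!: derivative_eq_intros)
    show "0 \<le> b x" "0 \<le> - \<nu> * (F / \<mu> * (- x))" if "x \<in> {0..1}" for x
      using ab(3)[OF that] D F \<mu> \<nu> that by auto
  qed (use \<mu> T C21_has_derivatives[OF C] cont in \<open>auto intro!: DERIV_minus simp: case_prod_beta continuous_on_minus\<close>)
  have "integral {0..1} (\<lambda>x. (u x T)\<^sup>2)
      \<le> integral {0..1} (\<lambda>x. 2 * M\<^sup>2 + (2 * (p T x)\<^sup>2 + 2 * (q T x)\<^sup>2))"
  proof (intro integral_le integrable_continuous_interval continuous_intros cpq)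
    show "(u x T)\<^sup>2 \<le> 2 * M\<^sup>2 + (2 * (p T x)\<^sup>2 + 2 * (q T x)\<^sup>2)" if "x \<in> {0..1}" for x
      unfolding p_def q_def using ab[OF that] D by (intro power2_le_of_two_sided_excess) auto
  qed
  also have "\<dots> = integral {0..1} (\<lambda>x::real. 2 * M\<^sup>2)
      + integral {0..1} (\<lambda>x. 2 * (p T x)\<^sup>2 + 2 * (q T x)\<^sup>2)"
    by (intro integral_add integrable_continuous_interval continuous_intros cpq)
  also have "integral {0..1} (\<lambda>x. 2 * (p T x)\<^sup>2 + 2 * (q T x)\<^sup>2)
      = integral {0..1} (\<lambda>x. 2 * (p T x)\<^sup>2) + integral {0..1} (\<lambda>x. 2 * (q T x)\<^sup>2)"
    by (intro integral_add integrable_continuous_interval continuous_intros cpq)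
  also have "\<dots> \<le> 2 * exp (- (\<mu> * T)) * (integral {0..1} (\<lambda>x. (p 0 x)\<^sup>2) + integral {0..1} (\<lambda>x. (q 0 x)\<^sup>2))"
    using p_decay q_decay by (simp add: algebra_simps)
  also have "integral {0..1} (\<lambda>x. (p 0 x)\<^sup>2) + integral {0..1} (\<lambda>x. (q 0 x)\<^sup>2)
      = integral {0..1} (\<lambda>x. (p 0 x)\<^sup>2 + (q 0 x)\<^sup>2)"
    by (intro integral_add[symmetric] integrable_continuous_interval continuous_intros cpq)
  also have "\<dots> \<le> integral {0..1} (\<lambda>x. (u x 0)\<^sup>2)"
  proof (intro integral_le integrable_continuous_interval continuous_intros cpq)
    show "(p 0 x)\<^sup>2 + (q 0 x)\<^sup>2 \<le> (u x 0)\<^sup>2" if "x \<in> {0..1}" for x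
      unfolding p_def q_def using ab[OF that] D by (intro two_sided_excess_le_power2) auto
  qed
  also have "integral {0..1} (\<lambda>x. (u x 0)\<^sup>2) = (L2_norm u\<^sub>0)\<^sup>2"
  proof -
    have "continuous_on {0..1} u\<^sub>0"
      by (rule continuous_on_eq[OF cu[OF order_refl] init])
    then have "(L2_norm u\<^sub>0)\<^sup>2 = integral {0..1} (\<lambda>x. (u\<^sub>0 x)\<^sup>2)"
      by (rule L2_norm_power2_eq_integral)
    also have "\<dots> = integral {0..1} (\<lambda>x. (u x 0)\<^sup>2)"
      using init by (intro integral_cong) simp
    finally show ?thesis by simp
  qed
  also have "integral {0..1} (\<lambda>x::real. 2 * M\<^sup>2) \<le> 4 * D\<^sup>2 + F\<^sup>2 / \<mu>\<^sup>2"
    using sum_squares_bound[of D "F / (2 * \<mu>)"] \<mu>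
    by (simp add: M_def power2_sum power_divide power_mult_distrib)
  finally show ?thesis
    using L2_norm_power2_eq_integral[OF cu[OF T]] by (simp add: algebra_simps)
qed

section \<open>Comparison functions and stability\<close>

lemma le_add3_of_power2_le:
  fixes a b c :: real
  assumes "0 \<le> a" "0 \<le> b" "0 \<le> c" "s\<^sup>2 \<le> a\<^sup>2 + b\<^sup>2 + c\<^sup>2"
  shows "s \<le> a + b + c"
proof (rule power2_le_imp_le)
  have "0 \<le> a * b + a * c + b * c" using assms by simp
  then show "s\<^sup>2 \<le> (a + b + c)\<^sup>2" using assms(4) by (simp add: power2_eq_square algebra_simps)
qed (use assms in auto)

lemma linear_class_K_inf:
  assumes "0 < (c::real)"
  shows "(\<lambda>s. c * s) \<in> class_K_inf"
proof -
  have "filterlim (\<lambda>s. c * s) at_top at_top"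
    by (rule filterlim_tendsto_pos_mult_at_top[OF tendsto_const assms filterlim_ident])
  then show ?thesis
    using assms by (auto simp: class_K_inf_def class_K_def strict_mono_on_def intro!: continuous_intros)
qed

lemma exponential_class_KL:
  assumes "0 < (c::real)" "0 < k"
  shows "(\<lambda>s t. c * s * exp (- (k * t))) \<in> class_KL"
proof -
  have "((\<lambda>t. exp (- (k * t))) \<longlongrightarrow> 0) at_top"
    using filterlim_tendsto_pos_mult_at_top[OF tendsto_const assms(2) filterlim_ident]
    by (intro filterlim_compose[OF exp_at_bot]) (simp add: filterlim_uminus_at_bot)
  then have lim: "((\<lambda>t. c * s * exp (- (k * t))) \<longlongrightarrow> 0) at_top" for s
    by (rule tendsto_mult_right_zero)
  have "(\<lambda>s. c * exp (- (k * t)) * s) \<in> class_K" for t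
    using linear_class_K_inf[of "c * exp (- (k * t))"] assms by (simp add: class_K_inf_def)
  then show ?thesis
    using assms lim
    by (auto simp: class_KL_def class_L_def monotone_on_def mult_ac intro!: continuous_intros)
qed

theorem theorem4:
  fixes \<mu> \<nu> \<theta> :: real
  assumes "\<mu> > 0" and "\<nu> > 0" and "0 < \<theta>" and "\<theta> < 1"
  shows "EISS_L2 (burgers_system \<mu> \<nu> \<theta>) \<and>
    (\<forall>u\<^sub>0 d f u. burgers_system \<mu> \<nu> \<theta> u\<^sub>0 d f u \<longrightarrow>
      (\<forall>t>0. (L2_norm (\<lambda>x. u x t))\<^sup>2 \<le>
         2 * (L2_norm u\<^sub>0)\<^sup>2 * exp (- (\<mu> * t))
         + 4 * (SUP s\<in>{0..t}. \<bar>d s\<bar>\<^sup>2)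
         + 128 / \<mu>\<^sup>2 * (SUP (x, s)\<in>{0..1} \<times> {0..t}. \<bar>f x s\<bar>\<^sup>2)))"
proof -
  have sup_facts: "\<bar>d s\<bar> \<le> (SUP s\<in>{0..t}. \<bar>d s\<bar>)" "\<bar>d s\<bar>\<^sup>2 \<le> (SUP s\<in>{0..t}. \<bar>d s\<bar>\<^sup>2)"
      "\<bar>f x s\<bar> \<le> (SUP (x, s)\<in>{0..1} \<times> {0..t}. \<bar>f x s\<bar>)"
      "\<bar>f x s\<bar>\<^sup>2 \<le> (SUP (x, s)\<in>{0..1} \<times> {0..t}. \<bar>f x s\<bar>\<^sup>2)"
    if sys: "burgers_system \<mu> \<nu> \<theta> u\<^sub>0 d f u" and x: "x \<in> {0..1}" and s: "s \<in> {0..t}"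
    for u\<^sub>0 d f u t x s
  proof -
    obtain A where A: "\<bar>d s\<bar> \<le> A" if "0 \<le> s" for s
      using sys by (auto simp: burgers_system_def admissible_disturbances_def H_boundary_def bounded_iff)
    obtain B where B: "\<bar>f x s\<bar> \<le> B" if "x \<in> {0..1}" "0 \<le> s" for x s
      using sys by (fastforce simp: burgers_system_def admissible_disturbances_def H_parabolic_def bounded_iff)
    have A2: "\<bar>d s\<bar>\<^sup>2 \<le> A\<^sup>2" if "0 \<le> s" for s using A[OF that] by (intro power_mono) auto
    have B2: "\<bar>f x s\<bar>\<^sup>2 \<le> B\<^sup>2" if "x \<in> {0..1}" "0 \<le> s" for x s
      using B[OF that] by (intro power_mono) auto
    show "\<bar>d s\<bar> \<le> (SUP s\<in>{0..t}. \<bar>d s\<bar>)"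
      using s A by (intro cSUP_upper bdd_aboveI2[where M = A]) auto
    show "\<bar>d s\<bar>\<^sup>2 \<le> (SUP s\<in>{0..t}. \<bar>d s\<bar>\<^sup>2)"
      using s A2 by (intro cSUP_upper bdd_aboveI2[where M = "A\<^sup>2"]) auto
    show "\<bar>f x s\<bar> \<le> (SUP (x, s)\<in>{0..1} \<times> {0..t}. \<bar>f x s\<bar>)"
      using s x B
      by (intro cSUP_upper2[where x = "(x, s)"] bdd_aboveI2[where M = B]) auto
    show "\<bar>f x s\<bar>\<^sup>2 \<le> (SUP (x, s)\<in>{0..1} \<times> {0..t}. \<bar>f x s\<bar>\<^sup>2)"
      using s x B2
      by (intro cSUP_upper2[where x = "(x, s)"] bdd_aboveI2[where M = "B\<^sup>2"]) auto
  qed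
  have estimate: "(L2_norm (\<lambda>x. u x t))\<^sup>2 \<le>
         2 * (L2_norm u\<^sub>0)\<^sup>2 * exp (- (\<mu> * t)) + 4 * D\<^sup>2 + 128 / \<mu>\<^sup>2 * F\<^sup>2"
    if sys: "burgers_system \<mu> \<nu> \<theta> u\<^sub>0 d f u" and t: "0 \<le> t"
      and D: "\<And>s. s \<in> {0..t} \<Longrightarrow> \<bar>d s\<bar> \<le> D"
      and F: "\<And>x s. x \<in> {0..1} \<Longrightarrow> s \<in> {0..t} \<Longrightarrow> \<bar>f x s\<bar> \<le> F"
    for u\<^sub>0 d f u t D F
  proof -
    have "(L2_norm (\<lambda>x. u x t))\<^sup>2
        \<le> 2 * (L2_norm u\<^sub>0)\<^sup>2 * exp (- (\<mu> * t)) + 4 * D\<^sup>2 + F\<^sup>2 / \<mu>\<^sup>2"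
      using assms sys by (intro burgers_energy_estimate[where \<nu> = \<nu>, OF _ _ t _ D F]) (auto simp: burgers_system_def)
    moreover have "F\<^sup>2 / \<mu>\<^sup>2 \<le> 128 / \<mu>\<^sup>2 * F\<^sup>2" using assms by (simp add: field_simps)
    ultimately show ?thesis by linarith
  qed
  have "(L2_norm (\<lambda>x. u x t))\<^sup>2 \<le>
         2 * (L2_norm u\<^sub>0)\<^sup>2 * exp (- (\<mu> * t))
         + 4 * (SUP s\<in>{0..t}. \<bar>d s\<bar>\<^sup>2)
         + 128 / \<mu>\<^sup>2 * (SUP (x, s)\<in>{0..1} \<times> {0..t}. \<bar>f x s\<bar>\<^sup>2)"
    if sys: "burgers_system \<mu> \<nu> \<theta> u\<^sub>0 d f u" and t: "0 < t" for u\<^sub>0 d f u t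
  proof -
    (* The suprema here are of squares, so their square roots serve as bounds on |d| and |f|. *)
    define D2 where "D2 = (SUP s\<in>{0..t}. \<bar>d s\<bar>\<^sup>2)"
    define F2 where "F2 = (SUP (x, s)\<in>{0..1} \<times> {0..t}. \<bar>f x s\<bar>\<^sup>2)"
    note sup = sup_facts(2,4)[OF sys, of _ _ t, folded D2_def F2_def]
    have "0 \<le> D2" "0 \<le> F2"
      using sup[of 0 0] t by (auto intro: order_trans[OF zero_le_power2])
    then have "(L2_norm (\<lambda>x. u x t))\<^sup>2
        \<le> 2 * (L2_norm u\<^sub>0)\<^sup>2 * exp (- (\<mu> * t)) + 4 * (sqrt D2)\<^sup>2 + 128 / \<mu>\<^sup>2 * (sqrt F2)\<^sup>2"
      using sup(1)[of 0] sup(2) t by (intro estimate[OF sys]) (auto intro!: real_le_rsqrt)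
    with \<open>0 \<le> D2\<close> \<open>0 \<le> F2\<close> show ?thesis by (simp add: D2_def F2_def)
  qed
  moreover have "EISS_L2 (burgers_system \<mu> \<nu> \<theta>)"
    unfolding EISS_L2_def ISS_L2_with_def
  proof (intro exI conjI allI impI)
    show "(\<lambda>r t. sqrt 2 * r * exp (- (\<mu> / 2 * t))) \<in> class_KL"
      using assms by (intro exponential_class_KL) auto
    show "(\<lambda>s. 2 * s) \<in> class_K" "(\<lambda>s. sqrt 128 / \<mu> * s) \<in> class_K"
      using linear_class_K_inf[of 2] linear_class_K_inf[of "sqrt 128 / \<mu>"] assms
      by (auto simp: class_K_inf_def)
    show "\<exists>\<beta>'\<in>class_K_inf. \<exists>c>0. \<forall>r\<ge>0. \<forall>t\<ge>0. sqrt 2 * r * exp (- (\<mu> / 2 * t)) \<le> \<beta>' r * exp (- (c * t))"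
      using assms by (intro bexI[of _ "\<lambda>r. sqrt 2 * r"] exI[of _ "\<mu> / 2"] linear_class_K_inf) auto
    fix u\<^sub>0 d f u t
    assume sys: "burgers_system \<mu> \<nu> \<theta> u\<^sub>0 d f u" and t: "0 \<le> (t::real)"
    define D where "D = (SUP s\<in>{0..t}. \<bar>d s\<bar>)"
    define F where "F = (SUP (x, s)\<in>{0..1} \<times> {0..t}. \<bar>f x s\<bar>)"
    note sup = sup_facts(1,3)[OF sys, of _ _ t, folded D_def F_def]
    have DF: "0 \<le> D" "0 \<le> F" using sup[of 0 0] t by auto
    have exp2: "(exp (- (\<mu> * t / 2)))\<^sup>2 = exp (- (\<mu> * t))"
      by (simp add: exp_double[symmetric])
    show "L2_norm (\<lambda>x. u x t) \<le> sqrt 2 * L2_norm u\<^sub>0 * exp (- (\<mu> / 2 * t)) + 2 * D + sqrt 128 / \<mu> * F"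
    proof (rule le_add3_of_power2_le)
      show "0 \<le> sqrt 2 * L2_norm u\<^sub>0 * exp (- (\<mu> / 2 * t))"
        by (auto simp: L2_norm_def set_lebesgue_integral_def intro!: mult_nonneg_nonneg integral_nonneg_AE)
      show "(L2_norm (\<lambda>x. u x t))\<^sup>2 \<le> (sqrt 2 * L2_norm u\<^sub>0 * exp (- (\<mu> / 2 * t)))\<^sup>2 + (2 * D)\<^sup>2
          + (sqrt 128 / \<mu> * F)\<^sup>2"
        using estimate[OF sys t, of D F, OF sup(1)[of 0] sup(2)]
        by (simp add: power_mult_distrib power_divide exp2)
    qed (use assms DF in auto)
  qed
  ultimately show ?thesis by blast
qed

end
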